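(* Let $G$ be a finite connected nonbipartite regular graph (loops and multiple edges allowed) with vertex set $V$ and vertex degree $d(v)=q+1\ge 3$ for all $v\in V$. There is a constant $C_G>0$ depending only on $G$ such that for every function $f:V\to\mathbb{R}$ there is a number $\beta_{\max}\in[q^{-1/2},1)$ such that both of the following hold with these same constants: (i) for every directed edge $a$ in $G$ and every integer $r\ge 0$, $\big|M_{r,a}(f)-\frac{1}{|V|}\sum_{v\in V}f(v)\big|\le C_G\|f\|_2\beta_{\max}^{\,r}$; (ii) for every vertex $v_0$ of the universal covering tree $\widetilde G$ and every integer $r\ge 0$, $$\Big|\frac{1}{|S_r(v_0)|}\sum_{v\in S_r(v_0)}\tilde f(v)-\frac{1}{|V|}\sum_{v\in V}f(v)\Big|\le C_G\,\|f\|_2\,\beta_{\max}^{\,r}.$$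
   Context: A loop at a vertex contributes $2$ to its degree. The norm is $\|f\|_2=\langle f,f\rangle^{1/2}$ with $\langle f,g\rangle=\sum_{v\in V}f(v)g(v)$. Universal cover: $\widetilde G$ is the universal covering tree of $G$, with vertex set $\widetilde V$: fix a root vertex of $G$; the vertices of $\widetilde G$ are the non-backtracking paths in $G$ starting at the root, two being adjacent if they differ by exactly one edge at the end. The projection $\pi:\widetilde G\to G$ sends a path to its end vertex. The lift of $f$ is $\tilde f=f\circ\pi$. $\delta$ is the combinatorial distance. Spheres and arcs: for $v_0\in\widetilde V$, $S_r(v_0)=\{v\in\widetilde V:\delta(v,v_0)=r\}$. For a directed edge $a$ of $\widetilde G$ from $w'$ to $w$, $A_0(a)=\{w'\}$ and $A_{r+1}(a)=S_{r+1}(w')\cap S_r(w)$ for $r\ge 0$, and $M_{r,a}(f)=\frac{1}{|A_r(a)|}\sum_{x\in A_r(a)}\tilde f(x)$. For a directed edge $a$ of $G$, $M_{r,a}(f)$ is computed using any lift of $a$ to $\widetilde G$ (the value does not depend on the lift). The constant $C_G$ does not depend on $a$, $v_0$, $f$, $r$; the rate $\beta_{\max}$ may depend on $G$ and $f$ but not on $a$, $v_0$ or $r$. *)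

theory Defs
  imports
    "HOL-Analysis.L2_Norm"
    "Graph_Theory.Arc_Walk"
    "Graph_Theory.Bidirected_Digraph"
    "Graph_Theory.Digraph_Component"
begin

text \<open>
  A finite graph with loops and multiple edges is a finite bidirected digraph \<open>G\<close>: its arcs are
  the directed edges, and the undirected edges are the pairs \<open>{e, arev e}\<close>. Since
  \<open>arev e \<noteq> e\<close> also for a loop, a loop accounts for two arcs leaving its vertex. Hence
  \<open>out_degree G v\<close> is the degree of \<open>v\<close>, with loops counted twice.
\<close>

definition bipartite :: "('a, 'b) pre_digraph \<Rightarrow> bool" where
  "bipartite G \<longleftrightarrow> (\<exists>X Y. X \<union> Y = verts G \<and> X \<inter> Y = {} \<and>
     (\<forall>e \<in> arcs G. (tail G e \<in> X \<and> head G e \<in> Y) \<or> (tail G e \<in> Y \<and> head G e \<in> X)))"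

text \<open>The value is meaningful only if \<open>v\<close> is reachable from \<open>u\<close>.\<close>

definition graph_dist :: "('a, 'b) pre_digraph \<Rightarrow> 'a \<Rightarrow> 'a \<Rightarrow> nat" where
  "graph_dist G u v = (LEAST n. \<exists>p. pre_digraph.awalk G u p v \<and> length p = n)"

definition graph_sphere :: "('a, 'b) pre_digraph \<Rightarrow> nat \<Rightarrow> 'a \<Rightarrow> 'a set" where
  "graph_sphere G r u = {v \<in> verts G. graph_dist G v u = r}"

fun graph_arc_set :: "('a, 'b) pre_digraph \<Rightarrow> nat \<Rightarrow> 'b \<Rightarrow> 'a set" where
  "graph_arc_set G 0 a = {tail G a}"
| "graph_arc_set G (Suc r) a = graph_sphere G (Suc r) (tail G a) \<inter> graph_sphere G r (head G a)"

definition mean_on :: "'a set \<Rightarrow> ('a \<Rightarrow> real) \<Rightarrow> real" where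
  "mean_on A f = (\<Sum>x\<in>A. f x) / real (card A)"

definition nb_paths :: "('a, 'b) pre_digraph \<Rightarrow> ('b \<Rightarrow> 'b) \<Rightarrow> 'a \<Rightarrow> 'b list set" where
  "nb_paths G arev rt =
     {p. (\<exists>v. pre_digraph.awalk G rt p v) \<and> successively (\<lambda>e e'. e' \<noteq> arev e) p}"

text \<open>
  Each edge of the tree gives two arcs, one in each direction, so walks in this digraph are walks
  in the undirected tree.
\<close>

definition universal_cover ::
  "('a, 'b) pre_digraph \<Rightarrow> ('b \<Rightarrow> 'b) \<Rightarrow> 'a \<Rightarrow> ('b list, 'b list \<times> 'b list) pre_digraph" where
  "universal_cover G arev rt =
     \<lparr> verts = nb_paths G arev rt,
       arcs = {(p, p'). p \<in> nb_paths G arev rt \<and> p' \<in> nb_paths G arev rt \<and>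
                        (\<exists>e. p' = p @ [e] \<or> p = p' @ [e])},
       tail = fst, head = snd \<rparr>"

definition cover_proj :: "('a, 'b) pre_digraph \<Rightarrow> 'a \<Rightarrow> 'b list \<Rightarrow> 'a" where
  "cover_proj G rt p = pre_digraph.awlast G rt p"

text \<open>The arc from \<open>p' @ [e]\<close> back to \<open>p'\<close> traverses \<open>e\<close> backwards, so it lies over \<open>arev e\<close>.\<close>

definition cover_lifts ::
  "('a, 'b) pre_digraph \<Rightarrow> ('b \<Rightarrow> 'b) \<Rightarrow> 'a \<Rightarrow> 'b \<Rightarrow> ('b list \<times> 'b list) set" where
  "cover_lifts G arev rt a =
     {(p, p') \<in> arcs (universal_cover G arev rt). p' = p @ [a] \<or> p = p' @ [arev a]}"

definition arc_mean :: "('a, 'b) pre_digraph \<Rightarrow> ('b \<Rightarrow> 'b) \<Rightarrow> 'a \<Rightarrow> ('a \<Rightarrow> real) \<Rightarrow>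
    nat \<Rightarrow> 'b list \<times> 'b list \<Rightarrow> real" where
  "arc_mean G arev rt f r a =
     mean_on (graph_arc_set (universal_cover G arev rt) r a) (f \<circ> cover_proj G rt)"

definition sphere_mean :: "('a, 'b) pre_digraph \<Rightarrow> ('b \<Rightarrow> 'b) \<Rightarrow> 'a \<Rightarrow> ('a \<Rightarrow> real) \<Rightarrow>
    nat \<Rightarrow> 'b list \<Rightarrow> real" where
  "sphere_mean G arev rt f r v =
     mean_on (graph_sphere (universal_cover G arev rt) r v) (f \<circ> cover_proj G rt)"

lemma wf_universal_cover: "wf_digraph (universal_cover G arev rt)"
  by unfold_locales (auto simp: universal_cover_def)

text \<open>Every directed edge has a lift, so a statement about all its lifts is not vacuous.\<close>

context bidirected_digraph
begin

lemma butlast_nb_paths: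
  assumes "p @ [e] \<in> nb_paths G arev rt"
  shows "p \<in> nb_paths G arev rt"
proof -
  from assms obtain v where "awalk rt (p @ [e]) v" by (auto simp: nb_paths_def)
  then have "awalk rt p (awlast rt p)" by (simp only: awalk_append_iff)
  with assms show ?thesis by (auto simp: nb_paths_def successively_append_iff)
qed

lemma snoc_nb_paths:
  assumes "p \<in> nb_paths G arev rt" "e \<in> arcs G" "tail G e = awlast rt p"
    and "p \<noteq> [] \<Longrightarrow> e \<noteq> arev (last p)"
  shows "p @ [e] \<in> nb_paths G arev rt"
proof -
  have "awalk rt (p @ [e]) (head G e)"
    using assms(1-3) by (auto simp: nb_paths_def awalk_Cons_iff awalk_Nil_iff)
  with assms show ?thesis by (auto simp: nb_paths_def successively_append_iff)
qed

lemma ex_nb_path: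
  assumes "awalk rt p v"
  shows "\<exists>p' \<in> nb_paths G arev rt. awlast rt p' = v"
  using assms
proof (induction p arbitrary: v rule: rev_induct)
  case Nil
  then show ?case by (intro bexI[of _ "[]"]) (auto simp: nb_paths_def awalk_def)
next
  case (snoc e p)
  then have e: "e \<in> arcs G" "head G e = v" and "awalk rt p (tail G e)"
    by (auto simp: awalk_Cons_iff)
  with snoc.IH obtain p' where p': "p' \<in> nb_paths G arev rt" "awlast rt p' = tail G e"
    by blast
  show ?case
  proof (cases "p' \<noteq> [] \<and> e = arev (last p')")
    case True
    then have *: "p' = butlast p' @ [arev e]" by simp
    with p' have "butlast p' \<in> nb_paths G arev rt" using butlast_nb_paths by metis
    moreover have "awlast rt (butlast p') = v"
    proof -
      from p' obtain w where "awalk rt (butlast p' @ [arev e]) w"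
        using * by (auto simp: nb_paths_def)
      then show ?thesis using e by (auto simp: awalk_Cons_iff)
    qed
    ultimately show ?thesis by blast
  next
    case False
    with p' e have "p' @ [e] \<in> nb_paths G arev rt" by (intro snoc_nb_paths) auto
    moreover have "awlast rt (p' @ [e]) = v" using e by (simp add: awalk_verts_conv)
    ultimately show ?thesis by blast
  qed
qed

lemma cover_lifts_nonempty:
  assumes "Digraph_Component.connected G" "rt \<in> verts G" "a \<in> arcs G"
  shows "cover_lifts G arev rt a \<noteq> {}"
proof -
  have "symmetric G"
    unfolding symmetric_def
  proof (rule symI)
    fix x y assume "(x, y) \<in> arcs_ends G"
    then obtain e where "e \<in> arcs G" "tail G e = x" "head G e = y" by (auto simp: arcs_ends_conv)
    then show "(y, x) \<in> arcs_ends G"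
      by (auto simp: arcs_ends_conv intro!: image_eqI[where x = "arev e"])
  qed
  then have "reachable G rt (tail G a)"
    using symmetric_connected_imp_strongly_connected assms by (auto simp: strongly_connected_def)
  then obtain p where p: "p \<in> nb_paths G arev rt" "awlast rt p = tail G a"
    using ex_nb_path unfolding reachable_awalk by blast
  show ?thesis
  proof (cases "p \<noteq> [] \<and> a = arev (last p)")
    case True
    then have "p = butlast p @ [arev a]" by simp
    moreover from this p have "butlast p \<in> nb_paths G arev rt" using butlast_nb_paths by metis
    ultimately have "(p, butlast p) \<in> cover_lifts G arev rt a"
      using p by (auto simp: cover_lifts_def universal_cover_def)
    then show ?thesis by blast
  next
    case False
    with p assms have "p @ [a] \<in> nb_paths G arev rt" by (intro snoc_nb_paths) auto
    with p have "(p, p @ [a]) \<in> cover_lifts G arev rt a"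
      by (auto simp: cover_lifts_def universal_cover_def)
    then show ?thesis by blast
  qed
qed

end

end

theory Submission
  imports Defs "HOL-Analysis.Function_Topology" "HOL-Library.Sublist"
begin

text \<open>
  Let \<open>T\<close> be the averaging operator of the nonbacktracking random walk on the directed edges of \<open>G\<close>.
  In the covering tree, an arc of radius \<open>r + 2\<close> over a directed edge \<open>a\<close> is the disjoint union of the
  arcs of radius \<open>r + 1\<close> over the \<open>q\<close> directed edges that may follow \<open>a\<close>. Hence the mean over an arc of
  radius \<open>r\<close> is \<open>(T ^ r F) a\<close>, where \<open>F b = f (tail b)\<close> (\<open>arc_mean_eq_nb_avg_pow\<close>), and the mean over a
  sphere is the average of this over the \<open>q + 1\<close> directed edges that leave its centre
  (\<open>sphere_mean_eq_nb_avg_pow\<close>). Everything reduces to the exponential decay of \<open>T ^ r g\<close> for functions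
  \<open>g\<close> of mean zero, with constants that depend only on \<open>G\<close>.

  Up to the reversal of directed edges, \<open>T\<close> is a direct sum of symmetric blocks, one for each vertex,
  with eigenvalue \<open>1\<close> on constants and \<open>- 1 / q\<close> elsewhere. So \<open>T\<close> does not increase the
  \<open>\<ell>\<^sup>2\<close> norm, and preserves the norm of \<open>g\<close> only if \<open>g\<close> is a function of the initial vertex
  (\<open>energy_nb_avg_eq\<close>). If \<open>T\<close> preserves the norm twice in a row, then connectedness and the absence of
  a bipartition force \<open>g\<close> to be constant (\<open>energy_nb_avg_twice_less\<close>). Thus \<open>T\<^sup>2\<close> strictly decreases the
  norm of each nonzero function of mean zero, and by compactness of the unit sphere it contracts by a
  uniform factor (\<open>energy_nb_avg_twice_contracts\<close>). This factor, and with
  it the rate \<open>\<beta>\<close>, depends only on \<open>G\<close>.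

  The geometry of the tree enters through the fact that from each vertex exactly one edge
  leads closer to a given other vertex (\<open>ex1_step_closer\<close>). This holds for the explicit
  function \<open>tree_dist\<close> of two reduced paths, and it implies that \<open>tree_dist\<close> is the distance in the
  tree (\<open>graph_dist_universal_cover\<close>).
\<close>

section \<open>From strict to uniform contraction\<close>

text \<open>
  On the nonzero functions of mean zero, a continuous function that is homogeneous of degree two and
  strictly smaller than the square norm is smaller by a uniform factor, because by homogeneity it is
  enough to compare the two on the unit sphere, which is compact. The function
  space \<open>'b \<Rightarrow> real\<close> carries the product topology and \<open>'b\<close> may be infinite, so the sphere is cut
  out of a cube that is degenerate in the coordinates outside \<open>A\<close>.
\<close>

lemma strict_contraction_imp_uniform:
  fixes Q :: "('b \<Rightarrow> real) \<Rightarrow> real"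
  assumes fin: "finite A" and cont: "continuous_on UNIV Q"
    and scale: "\<And>c g. Q (\<lambda>x. c * g x) = c\<^sup>2 * Q g"
    and local: "\<And>g h. (\<And>x. x \<in> A \<Longrightarrow> g x = h x) \<Longrightarrow> Q g = Q h"
    and strict: "\<And>g. sum g A = 0 \<Longrightarrow> \<exists>x\<in>A. g x \<noteq> 0 \<Longrightarrow> Q g < (\<Sum>x\<in>A. (g x)\<^sup>2)"
  obtains \<rho> where "0 \<le> \<rho>" "\<rho> < 1"
    "\<And>g. sum g A = 0 \<Longrightarrow> Q g \<le> \<rho> * (\<Sum>x\<in>A. (g x)\<^sup>2)"
proof -
  define K :: "('b \<Rightarrow> real) set" where
    "K = Pi\<^sub>E UNIV (\<lambda>x. if x \<in> A then {-1..1} else {0})"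
  define S where "S = K \<inter> {g. sum g A = 0} \<inter> {g. (\<Sum>x\<in>A. (g x)\<^sup>2) = 1}"
  have "compactin (product_topology (\<lambda>_. euclidean) UNIV) K"
    unfolding K_def compactin_PiE by auto
  then have "compact K"
    by (simp add: euclidean_product_topology)
  moreover have "closed {g :: 'b \<Rightarrow> real. sum g A = 0}"
    by (intro closed_Collect_eq continuous_intros continuous_on_product_coordinates)
  moreover have "closed {g :: 'b \<Rightarrow> real. (\<Sum>x\<in>A. (g x)\<^sup>2) = 1}"
    by (intro closed_Collect_eq continuous_intros continuous_on_product_coordinates)
  ultimately have "compact S"
    unfolding S_def by (intro compact_Int_closed)
  have "\<exists>\<rho>\<ge>0. \<rho> < 1 \<and> (\<forall>h\<in>S. Q h \<le> \<rho>)"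
  proof (cases "S = {}")
    case False
    then obtain g where g: "g \<in> S" "\<And>h. h \<in> S \<Longrightarrow> Q h \<le> Q g"
      using continuous_attains_sup[OF \<open>compact S\<close> False continuous_on_subset[OF cont]] by auto
    have "\<exists>x\<in>A. g x \<noteq> 0"
    proof (rule ccontr)
      assume "\<not> ?thesis"
      then have "(\<Sum>x\<in>A. (g x)\<^sup>2) = 0" by simp
      with g(1) show False by (simp add: S_def)
    qed
    with strict[of g] g(1) have "Q g < 1" by (simp add: S_def)
    with g(2) show ?thesis by (intro exI[of _ "max 0 (Q g)"]) fastforce
  qed (auto intro: exI[of _ 0])
  then obtain \<rho> where \<rho>: "\<rho> \<ge> 0" "\<rho> < 1" "\<And>h. h \<in> S \<Longrightarrow> Q h \<le> \<rho>" by blast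
  show ?thesis
  proof (rule that[of \<rho>])
    fix g :: "'b \<Rightarrow> real" assume g0: "sum g A = 0"
    define N where "N = (\<Sum>x\<in>A. (g x)\<^sup>2)"
    have "N \<ge> 0" unfolding N_def by (intro sum_nonneg) simp
    show "Q g \<le> \<rho> * (\<Sum>x\<in>A. (g x)\<^sup>2)"
    proof (cases "N = 0")
      case True
      then have "\<And>x. x \<in> A \<Longrightarrow> g x = 0 * g x"
        using fin by (simp add: N_def sum_nonneg_eq_0_iff)
      then have "Q g = Q (\<lambda>x. 0 * g x)" by (rule local)
      also have "\<dots> = 0" by (simp only: scale) simp
      finally show ?thesis using True by (simp add: N_def)
    next
      case False
      with \<open>N \<ge> 0\<close> have "N > 0" by simp
      \<comment> \<open>The restriction of \<open>g\<close> to \<open>A\<close>, normalised so as to lie on the sphere.\<close>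
      define h where "h = (\<lambda>x. if x \<in> A then g x / sqrt N else 0)"
      have sq: "(\<Sum>x\<in>A. (h x)\<^sup>2) = 1"
        using \<open>N > 0\<close> by (simp add: h_def power_divide N_def flip: sum_divide_distrib)
      have "sum h A = 0"
        using g0 by (simp add: h_def flip: sum_divide_distrib)
      moreover have "h \<in> K"
        unfolding K_def
      proof (intro PiE_I)
        fix x
        show "h x \<in> (if x \<in> A then {-1..1} else {0})"
        proof (cases "x \<in> A")
          case True
          have "(h x)\<^sup>2 \<le> 1"
            using member_le_sum[of x A "\<lambda>x. (h x)\<^sup>2"] True fin sq by simp
          then show ?thesis using True by (simp add: abs_square_le_1 abs_le_iff)
        qed (simp add: h_def)
      qed simp
      ultimately have "Q h \<le> \<rho>" using \<rho>(3) sq by (simp add: S_def)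
      have "Q g = Q (\<lambda>x. sqrt N * h x)"
        using \<open>N > 0\<close> by (intro local) (simp add: h_def)
      also have "\<dots> = N * Q h" using \<open>N > 0\<close> by (simp only: scale) simp
      also have "\<dots> \<le> N * \<rho>" using \<open>Q h \<le> \<rho>\<close> \<open>N > 0\<close> by simp
      finally show ?thesis by (simp add: N_def mult.commute)
    qed
  qed (use \<rho> in auto)
qed

section \<open>The nonbacktracking averaging operator\<close>

text \<open>
  The matrix \<open>(J - I) / q\<close> of size \<open>q + 1\<close>, with \<open>J\<close> the all-ones matrix, has eigenvalue \<open>1\<close> on
  constants and \<open>- 1 / q\<close> on their orthogonal complement. The loss of square norm is therefore the
  variance part of \<open>g\<close>, scaled by \<open>1 - 1 / q\<^sup>2\<close>.
\<close>

lemma sum_sq_leave_one_out: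
  fixes g :: "'b \<Rightarrow> real"
  assumes "finite E" "card E = q + 1" "q \<ge> 1"
  defines "s \<equiv> sum g E"
  shows "(\<Sum>b\<in>E. (g b)\<^sup>2) - (\<Sum>b\<in>E. ((s - g b) / q)\<^sup>2)
       = (1 - 1 / (real q)\<^sup>2) * (\<Sum>b\<in>E. (g b - s / (real q + 1))\<^sup>2)"
proof -
  define Q where "Q = (\<Sum>b\<in>E. (g b)\<^sup>2)"
  have 1: "(\<Sum>b\<in>E. (g b - c)\<^sup>2) = Q - 2 * c * s + (real q + 1) * c\<^sup>2" for c
    using assms by (simp add: power2_diff sum.distrib sum_subtractf Q_def s_def
        flip: sum_distrib_left sum_distrib_right)
  have 2: "(\<Sum>b\<in>E. ((s - g b) / q)\<^sup>2) = (\<Sum>b\<in>E. (g b - s)\<^sup>2) / (real q)\<^sup>2"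
    by (simp add: power_divide power2_commute[of s] flip: sum_divide_distrib)
  have "real q + 1 \<noteq> 0" "real q \<noteq> 0" using \<open>q \<ge> 1\<close> by linarith+
  then show ?thesis
    unfolding 2 1 Q_def[symmetric] by (simp add: divide_simps) algebra
qed

locale regular_bidirected_digraph = fin_digraph G + bidirected_digraph G arev
  for G :: "('a, 'b) pre_digraph" and arev :: "'b \<Rightarrow> 'b" +
  fixes q :: nat
  assumes q_ge_2: "q \<ge> 2"
    and card_out_arcs: "v \<in> verts G \<Longrightarrow> card (out_arcs G v) = q + 1"
begin

text \<open>
  One step of the nonbacktracking random walk on directed edges: from \<open>a\<close> it moves to one of the \<open>q\<close>
  directed edges that start where \<open>a\<close> ends, other than the reversal of \<open>a\<close>.
\<close>

definition nb_avg :: "('b \<Rightarrow> real) \<Rightarrow> 'b \<Rightarrow> real" where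
  "nb_avg g a = (\<Sum>b\<in>out_arcs G (head G a) - {arev a}. g b) / q"

definition energy :: "('b \<Rightarrow> real) \<Rightarrow> real" where
  "energy g = (\<Sum>a\<in>arcs G. (g a)\<^sup>2)"

definition out_mean :: "('b \<Rightarrow> real) \<Rightarrow> 'a \<Rightarrow> real" where
  "out_mean g v = sum g (out_arcs G v) / (real q + 1)"

lemma arev_mem_out_arcs: "a \<in> arcs G \<Longrightarrow> arev a \<in> out_arcs G (head G a)"
  by simp

lemma card_successors:
  assumes "a \<in> arcs G"
  shows "card (out_arcs G (head G a) - {arev a}) = q"
  using assms card_out_arcs[of "head G a"] arev_mem_out_arcs[of a] by simp

lemma nb_avg_cong:
  assumes "\<And>b. b \<in> arcs G \<Longrightarrow> g b = h b"
  shows "nb_avg g a = nb_avg h a"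
  unfolding nb_avg_def by (intro arg_cong2[where f = "(/)"] sum.cong) (auto simp: assms)

lemma nb_avg_tail:
  assumes "a \<in> arcs G" and "\<And>b. b \<in> arcs G \<Longrightarrow> g b = h (tail G b)"
  shows "nb_avg g a = h (head G a)"
proof -
  have "(\<Sum>b\<in>out_arcs G (head G a) - {arev a}. g b) = real q * h (head G a)"
    using card_successors[OF assms(1)] assms(2) by (simp add: out_arcs_def)
  then show ?thesis using q_ge_2 by (simp add: nb_avg_def)
qed

lemma nb_avg_diff_const:
  assumes "a \<in> arcs G"
  shows "nb_avg (\<lambda>b. g b - c) a = nb_avg g a - c"
  using card_successors[OF assms] q_ge_2
  by (simp add: nb_avg_def sum_subtractf diff_divide_distrib)

lemma nb_avg_scale: "nb_avg (\<lambda>b. c * g b) a = c * nb_avg g a"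
  by (simp add: nb_avg_def flip: sum_distrib_left)

text \<open>
  After the relabelling by \<open>arev\<close> the operator splits into one block for each vertex \<open>v\<close>, acting on
  the directed edges that leave \<open>v\<close>; the block is the matrix of \<open>sum_sq_leave_one_out\<close>. The
  relabelling is a bijection of the directed edges, so it changes neither sums nor energies.
\<close>

lemma nb_avg_arev:
  assumes "b \<in> out_arcs G v"
  shows "nb_avg g (arev b) = (sum g (out_arcs G v) - g b) / q"
  using assms by (simp add: nb_avg_def sum_diff1 finite_out_arcs)

lemma sum_arcs_by_tail: "sum h (arcs G) = (\<Sum>v\<in>verts G. \<Sum>b\<in>out_arcs G v. h b)"
  using sum.group[of "arcs G" "verts G" "tail G" h] by (simp add: out_arcs_def image_subset_iff)

lemma sum_arcs_arev: "(\<Sum>a\<in>arcs G. h (arev a)) = sum h (arcs G)"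
  by (rule sum.permute[OF arev_permutes_arcs, symmetric, unfolded comp_def])

lemma sum_nb_avg: "sum (nb_avg g) (arcs G) = sum g (arcs G)"
proof -
  have "sum (nb_avg g) (arcs G) = (\<Sum>b\<in>arcs G. nb_avg g (arev b))"
    by (simp add: sum_arcs_arev)
  also have "\<dots> = (\<Sum>v\<in>verts G. \<Sum>b\<in>out_arcs G v. (sum g (out_arcs G v) - g b) / q)"
    unfolding sum_arcs_by_tail by (intro sum.cong refl nb_avg_arev)
  also have "\<dots> = (\<Sum>v\<in>verts G. sum g (out_arcs G v))"
  proof (rule sum.cong[OF refl])
    fix v assume "v \<in> verts G"
    then have "(\<Sum>b\<in>out_arcs G v. sum g (out_arcs G v) - g b) = real q * sum g (out_arcs G v)"
      by (simp add: sum_subtractf card_out_arcs algebra_simps)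
    then show "(\<Sum>b\<in>out_arcs G v. (sum g (out_arcs G v) - g b) / q) = sum g (out_arcs G v)"
      using q_ge_2 by (simp flip: sum_divide_distrib)
  qed
  finally show ?thesis by (simp add: sum_arcs_by_tail)
qed

lemma energy_nb_avg:
  "energy (nb_avg g) = energy g
     - (1 - 1 / (real q)\<^sup>2) * (\<Sum>b\<in>arcs G. (g b - out_mean g (tail G b))\<^sup>2)"
proof -
  have "energy (nb_avg g) = (\<Sum>b\<in>arcs G. (nb_avg g (arev b))\<^sup>2)"
    unfolding energy_def by (rule sum_arcs_arev[symmetric])
  also have "\<dots> = (\<Sum>v\<in>verts G. \<Sum>b\<in>out_arcs G v. ((sum g (out_arcs G v) - g b) / q)\<^sup>2)"
    unfolding sum_arcs_by_tail by (intro sum.cong refl) (simp only: nb_avg_arev)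
  also have "\<dots> = (\<Sum>v\<in>verts G. (\<Sum>b\<in>out_arcs G v. (g b)\<^sup>2)
      - (1 - 1 / (real q)\<^sup>2) * (\<Sum>b\<in>out_arcs G v. (g b - out_mean g (tail G b))\<^sup>2))"
  proof (intro sum.cong refl)
    fix v assume "v \<in> verts G"
    then show "(\<Sum>b\<in>out_arcs G v. ((sum g (out_arcs G v) - g b) / q)\<^sup>2)
      = (\<Sum>b\<in>out_arcs G v. (g b)\<^sup>2)
        - (1 - 1 / (real q)\<^sup>2) * (\<Sum>b\<in>out_arcs G v. (g b - out_mean g (tail G b))\<^sup>2)"
      using sum_sq_leave_one_out[of "out_arcs G v" q g] card_out_arcs q_ge_2
      by (simp add: out_mean_def finite_out_arcs)
  qed
  finally show ?thesis
    by (simp add: sum_subtractf energy_def sum_arcs_by_tail flip: sum_distrib_left)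
qed

lemma one_minus_inverse_square_pos: "1 - 1 / (real q)\<^sup>2 > 0"
proof -
  have "1 < (real q)\<^sup>2" using q_ge_2 by (intro one_less_power) auto
  then show ?thesis by (simp add: divide_less_eq)
qed

lemma energy_nb_avg_le: "energy (nb_avg g) \<le> energy g"
  using one_minus_inverse_square_pos
  by (simp add: energy_nb_avg sum_nonneg)

text \<open>
  The energy is preserved only if the variance vanishes in each block, so that the function factors
  through the initial vertex of a directed edge.
\<close>

lemma energy_nb_avg_eq:
  assumes "energy (nb_avg g) = energy g" "b \<in> arcs G"
  shows "g b = out_mean g (tail G b)"
proof -
  have "(\<Sum>b\<in>arcs G. (g b - out_mean g (tail G b))\<^sup>2) = 0"
    using assms(1) one_minus_inverse_square_pos unfolding energy_nb_avg by auto
  then show ?thesis using assms(2) by (simp add: sum_nonneg_eq_0_iff)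
qed

end

context bidirected_digraph
begin

lemma connected_invariant_const:
  assumes "Digraph_Component.connected G"
    and inv: "\<And>a. a \<in> arcs G \<Longrightarrow> \<phi> (head G a) = \<phi> (tail G a)"
    and "u \<in> verts G" "v \<in> verts G"
  shows "\<phi> u = \<phi> v"
proof -
  have "strongly_connected G"
    using symmetric_connected_imp_strongly_connected assms(1) sym_arcs by blast
  with assms obtain p where "awalk u p v"
    unfolding strongly_connected_def reachable_awalk by blast
  then show ?thesis
    by (induction p arbitrary: u) (auto simp: awalk_simps simp flip: inv)
qed

end

context regular_bidirected_digraph
begin

text \<open>
  Suppose that two steps preserve the energy. Then \<open>g\<close> is a function \<open>h\<close> of the initial vertex, and
  \<open>nb_avg g\<close> is the same function \<open>h\<close> of the terminal vertex. The second step forces the latter to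
  be also a function \<open>k\<close> of the initial vertex. Hence \<open>h\<close> and \<open>k\<close> are exchanged along every edge: the
  sign of \<open>h - k\<close> alternates, which is a bipartition unless \<open>h = k\<close>, and then \<open>h\<close> is constant. One
  step alone would not be enough, since it preserves the energy of every function of the initial
  vertex.
\<close>

lemma energy_nb_avg_twice_less:
  assumes conn: "Digraph_Component.connected G" and nbip: "\<not> bipartite G"
    and sum0: "sum g (arcs G) = 0" and nz: "\<exists>a\<in>arcs G. g a \<noteq> 0"
  shows "energy (nb_avg (nb_avg g)) < energy g"
proof (rule ccontr)
  assume "\<not> ?thesis"
  with energy_nb_avg_le[of g] energy_nb_avg_le[of "nb_avg g"]
  have eq: "energy (nb_avg g) = energy g" "energy (nb_avg (nb_avg g)) = energy (nb_avg g)"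
    by auto
  define h k where "h = out_mean g" and "k = out_mean (nb_avg g)"
  have g: "g a = h (tail G a)" if "a \<in> arcs G" for a
    using energy_nb_avg_eq[OF eq(1) that] by (simp add: h_def)
  have hk: "k (tail G a) = h (head G a)" if "a \<in> arcs G" for a
    using energy_nb_avg_eq[OF eq(2) that] nb_avg_tail[OF that, of g h] g by (simp add: k_def)
  have kh: "k (head G a) = h (tail G a)" if "a \<in> arcs G" for a
    using hk[of "arev a"] that by simp
  have hk_eq: "h v = k v" if "v \<in> verts G" for v
  proof (rule ccontr)
    assume ne: "h v \<noteq> k v"
    have "\<bar>h u - k u\<bar> = \<bar>h v - k v\<bar>" if "u \<in> verts G" for u
      by (rule connected_invariant_const[OF conn _ that \<open>v \<in> verts G\<close>])
        (simp add: hk kh abs_minus_commute)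
    with ne have ne': "h u \<noteq> k u" if "u \<in> verts G" for u
      using that by fastforce
    let ?X = "{v \<in> verts G. h v > k v}" and ?Y = "{v \<in> verts G. h v < k v}"
    have "?X \<union> ?Y = verts G" using ne' by (auto simp: neq_iff)
    moreover have "?X \<inter> ?Y = {}" by auto
    moreover have "\<forall>e\<in>arcs G. (tail G e \<in> ?X \<and> head G e \<in> ?Y) \<or> (tail G e \<in> ?Y \<and> head G e \<in> ?X)"
      using ne' by (auto simp: hk kh) (metis head_in_verts hk kh linorder_less_linear)
    ultimately have "bipartite G" unfolding bipartite_def by blast
    with nbip show False by contradiction
  qed
  have const: "g a = g b" if "a \<in> arcs G" "b \<in> arcs G" for a b
    using connected_invariant_const[OF conn, of h "tail G a" "tail G b"] that g hk hk_eq
    by simp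
  from nz obtain a where a: "a \<in> arcs G" "g a \<noteq> 0" by blast
  have "sum g (arcs G) = card (arcs G) * g a"
    using const[OF _ a(1)] by simp
  with sum0 a show False by auto
qed

lemma continuous_on_nb_avg [continuous_intros]:
  fixes F :: "('b \<Rightarrow> real) \<Rightarrow> 'b \<Rightarrow> real"
  assumes "\<And>b. continuous_on UNIV (\<lambda>g. F g b)"
  shows "continuous_on UNIV (\<lambda>g. nb_avg (F g) a)"
  unfolding nb_avg_def using q_ge_2 by (intro continuous_intros assms) auto

lemma energy_nb_avg_twice_contracts:
  assumes "Digraph_Component.connected G" "\<not> bipartite G"
  obtains \<rho> where "0 \<le> \<rho>" "\<rho> < 1"
    "\<And>g. sum g (arcs G) = 0 \<Longrightarrow> energy (nb_avg (nb_avg g)) \<le> \<rho> * energy g"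
proof -
  let ?Q = "\<lambda>g. energy (nb_avg (nb_avg g))"
  have 1: "continuous_on UNIV ?Q"
    unfolding energy_def by (intro continuous_intros continuous_on_product_coordinates)
  have 2: "?Q (\<lambda>x. c * g x) = c\<^sup>2 * ?Q g" for c g
    by (simp add: nb_avg_scale energy_def power_mult_distrib sum_distrib_left cong: nb_avg_cong)
  have 3: "?Q g = ?Q h" if "\<And>x. x \<in> arcs G \<Longrightarrow> g x = h x" for g h
    using nb_avg_cong[of g h] that by (simp add: energy_def cong: nb_avg_cong)
  have 4: "?Q g < (\<Sum>a\<in>arcs G. (g a)\<^sup>2)" if "sum g (arcs G) = 0" "\<exists>a\<in>arcs G. g a \<noteq> 0" for g
    using energy_nb_avg_twice_less[OF assms that] by (simp add: energy_def)
  show ?thesis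
    by (rule strict_contraction_imp_uniform[OF finite_arcs 1 2 3 4])
      (auto intro: that simp: energy_def)
qed

text \<open>
  Pairs of steps contract by \<open>\<beta> ^ 4\<close>. For odd \<open>r\<close> a single step is left over, which is only known
  not to increase the energy; the factor \<open>q\<close> absorbs it, as \<open>q * \<beta>\<^sup>2 \<ge> 1\<close>.
\<close>

lemma energy_nb_avg_pow_le:
  assumes \<beta>: "1 / real q \<le> \<beta>\<^sup>2"
    and contr: "\<And>g. sum g (arcs G) = 0 \<Longrightarrow> energy (nb_avg (nb_avg g)) \<le> \<beta> ^ 4 * energy g"
    and "sum g (arcs G) = 0"
  shows "energy ((nb_avg ^^ r) g) \<le> real q * \<beta> ^ (2 * r) * energy g"
  using assms(3)
proof (induction r arbitrary: g rule: induct_nat_012)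
  case 0
  have "energy g \<ge> 0" by (simp add: energy_def sum_nonneg)
  with q_ge_2 show ?case using mult_right_mono[of 1 "real q" "energy g"] by simp
next
  case 1
  have "energy g \<ge> 0" by (simp add: energy_def sum_nonneg)
  then have "1 * energy g \<le> (real q * \<beta>\<^sup>2) * energy g"
    using \<beta> q_ge_2 by (intro mult_right_mono) (auto simp: field_simps)
  with energy_nb_avg_le[of g] show ?case by (simp add: power2_eq_square)
next
  case (ge2 n)
  have "sum (nb_avg (nb_avg g)) (arcs G) = 0" using ge2.prems by (simp add: sum_nb_avg)
  from ge2.IH(1)[OF this]
  have "energy ((nb_avg ^^ Suc (Suc n)) g) \<le> real q * \<beta> ^ (2 * n) * energy (nb_avg (nb_avg g))"
    by (simp add: funpow_Suc_right del: funpow.simps)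
  also have "\<dots> \<le> real q * \<beta> ^ (2 * n) * (\<beta> ^ 4 * energy g)"
    using contr[OF ge2.prems] by (intro mult_left_mono) auto
  also have "\<dots> = real q * \<beta> ^ (2 * Suc (Suc n)) * energy g"
    by (simp add: power_add flip: mult.assoc) (simp add: eval_nat_numeral)
  finally show ?case .
qed

end

section \<open>The metric of the universal covering tree\<close>

text \<open>
  The distance of two words in the tree of all words: the shortest path goes through their longest
  common prefix.
\<close>

fun tree_dist :: "'b list \<Rightarrow> 'b list \<Rightarrow> nat" where
  "tree_dist [] ys = length ys"
| "tree_dist xs [] = length xs"
| "tree_dist (x # xs) (y # ys) = (if x = y then tree_dist xs ys else length xs + length ys + 2)"

lemma tree_dist_Nil2 [simp]: "tree_dist xs [] = length xs"
  by (cases xs) auto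

lemma tree_dist_self [simp]: "tree_dist xs xs = 0"
  by (induction xs) auto

lemma tree_dist_sym: "tree_dist xs ys = tree_dist ys xs"
  by (induction xs ys rule: tree_dist.induct) auto

lemma tree_dist_eq_0_iff [simp]: "tree_dist xs ys = 0 \<longleftrightarrow> xs = ys"
  by (induction xs ys rule: tree_dist.induct) auto

text \<open>
  Appending a letter moves towards \<open>xs\<close> exactly when one stays on the branch that leads to \<open>xs\<close>.
\<close>

lemma tree_dist_snoc:
  "prefix (ys @ [e]) xs \<Longrightarrow> tree_dist xs ys = Suc (tree_dist xs (ys @ [e]))"
  "\<not> prefix (ys @ [e]) xs \<Longrightarrow> tree_dist xs (ys @ [e]) = Suc (tree_dist xs ys)"
proof (induction xs ys rule: tree_dist.induct)
  case (2 x xs)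
  { case 1 then show ?case by (cases xs) auto }
  { case 2 then show ?case by (cases xs) auto }
qed auto

context bidirected_digraph
begin

text \<open>
  The end point of the lift of the directed edge \<open>e\<close> that starts at the vertex \<open>w\<close> of the covering
  tree: traversing the last edge of \<open>w\<close> backwards removes it from the path.
\<close>

definition step :: "'b list \<Rightarrow> 'b \<Rightarrow> 'b list" where
  "step w e = (if w \<noteq> [] \<and> e = arev (last w) then butlast w else w @ [e])"

lemma cover_proj_snoc [simp]: "cover_proj G rt (w @ [e]) = head G e"
  by (simp add: cover_proj_def awalk_verts_conv)

lemma universal_cover_simps [simp]:
  "verts (universal_cover G arev rt) = nb_paths G arev rt"
  "tail (universal_cover G arev rt) = fst"
  "head (universal_cover G arev rt) = snd"
  by (simp_all add: universal_cover_def)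

lemma nb_paths_snoc_iff:
  "w @ [e] \<in> nb_paths G arev rt \<longleftrightarrow> w \<in> nb_paths G arev rt \<and> e \<in> arcs G \<and>
     tail G e = cover_proj G rt w \<and> (w \<noteq> [] \<longrightarrow> e \<noteq> arev (last w))"
  (is "?L \<longleftrightarrow> ?R")
proof
  assume L: ?L
  then obtain v where "awalk rt (w @ [e]) v" by (auto simp: nb_paths_def)
  then have "e \<in> arcs G" "tail G e = cover_proj G rt w"
    by (auto simp: cover_proj_def awalk_Cons_iff)
  with L butlast_nb_paths[OF L] show ?R
    by (auto simp: nb_paths_def successively_append_iff)
qed (auto simp: cover_proj_def intro: snoc_nb_paths)

text \<open>
  The projection is a local isomorphism: the directed edges at a vertex of the tree correspond to
  the directed edges at its image.
\<close>

lemma cover_arc_iff: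
  assumes "w \<in> nb_paths G arev rt"
  shows "(w, w') \<in> arcs (universal_cover G arev rt) \<longleftrightarrow>
     (\<exists>e\<in>out_arcs G (cover_proj G rt w). w' = step w e)"
proof
  assume "(w, w') \<in> arcs (universal_cover G arev rt)"
  then consider e where "w' = w @ [e]" "w' \<in> nb_paths G arev rt"
    | e where "w = w' @ [e]"
    by (auto simp: universal_cover_def)
  then show "\<exists>e\<in>out_arcs G (cover_proj G rt w). w' = step w e"
  proof cases
    case 1
    then show ?thesis by (auto simp: nb_paths_snoc_iff step_def intro!: bexI[of _ e])
  next
    case 2
    with assms show ?thesis
      by (auto simp: nb_paths_snoc_iff step_def intro!: bexI[of _ "arev e"])
  qed
next
  assume "\<exists>e\<in>out_arcs G (cover_proj G rt w). w' = step w e"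
  then obtain e where e: "e \<in> arcs G" "tail G e = cover_proj G rt w" "w' = step w e" by auto
  show "(w, w') \<in> arcs (universal_cover G arev rt)"
  proof (cases "w \<noteq> [] \<and> e = arev (last w)")
    case True
    then obtain y b where w: "w = y @ [b]" by (cases w rule: rev_cases) auto
    then have "y \<in> nb_paths G arev rt" using assms butlast_nb_paths by blast
    with True w assms e show ?thesis
      by (auto simp: universal_cover_def step_def)
  next
    case False
    with assms e show ?thesis
      by (auto simp: universal_cover_def step_def nb_paths_snoc_iff)
  qed
qed

lemma step_mem_cover_lifts:
  assumes "w \<in> nb_paths G arev rt" "e \<in> out_arcs G (cover_proj G rt w)"
  shows "(w, step w e) \<in> cover_lifts G arev rt e"
proof -
  have "(w, step w e) \<in> arcs (universal_cover G arev rt)"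
    using cover_arc_iff assms by blast
  then show ?thesis
    by (auto simp: cover_lifts_def step_def)
qed

lemma cover_liftsD:
  assumes "(w', w) \<in> cover_lifts G arev rt a" "a \<in> arcs G"
  shows "w' \<in> nb_paths G arev rt" "w \<in> nb_paths G arev rt"
    "cover_proj G rt w' = tail G a" "cover_proj G rt w = head G a" "w' = step w (arev a)"
  using assms by (auto simp: cover_lifts_def universal_cover_def nb_paths_snoc_iff step_def)

lemma tree_dist_step_cases:
  "tree_dist x (step w e) = Suc (tree_dist x w) \<or> tree_dist x w = Suc (tree_dist x (step w e))"
proof (cases "w \<noteq> [] \<and> e = arev (last w)")
  case True
  then show ?thesis
    using tree_dist_snoc[of "butlast w" "last w" x] by (auto simp: step_def)
next
  case False
  then show ?thesis using tree_dist_snoc[of w e x] by (auto simp: step_def)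
qed

text \<open>
  The defining property of a tree: from \<open>w\<close> exactly one edge leads towards \<open>x\<close>. It prolongs
  \<open>w\<close> if \<open>w\<close> is a prefix of \<open>x\<close>, and shortens \<open>w\<close> otherwise.
\<close>

lemma ex1_step_closer:
  assumes "w \<in> nb_paths G arev rt" "x \<in> nb_paths G arev rt" "x \<noteq> w"
  shows "\<exists>!e. e \<in> out_arcs G (cover_proj G rt w) \<and> tree_dist x w = Suc (tree_dist x (step w e))"
proof (cases "prefix w x")
  case True
  with \<open>x \<noteq> w\<close> obtain e zs where x: "x = w @ e # zs"
    by (metis prefix_def append_Nil2 neq_Nil_conv)
  have "w @ [e] \<in> nb_paths G arev rt"
    using assms(2) unfolding x
  proof (induction zs rule: rev_induct)
    case (snoc z zs)
    then show ?case using butlast_nb_paths[of "w @ e # zs" z rt] by simp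
  qed simp
  then have e: "e \<in> out_arcs G (cover_proj G rt w)" "step w e = w @ [e]"
    by (auto simp: nb_paths_snoc_iff step_def)
  show ?thesis
  proof (rule ex1I[of _ e])
    show "e \<in> out_arcs G (cover_proj G rt w) \<and> tree_dist x w = Suc (tree_dist x (step w e))"
      using e tree_dist_snoc(1)[of w e x] x by simp
    fix e' assume e': "e' \<in> out_arcs G (cover_proj G rt w) \<and>
      tree_dist x w = Suc (tree_dist x (step w e'))"
    show "e' = e"
    proof (cases "w \<noteq> [] \<and> e' = arev (last w)")
      case True
      then have "tree_dist x (butlast w) = Suc (tree_dist x w)"
        using tree_dist_snoc(1)[of "butlast w" "last w" x] x by simp
      with e' True show ?thesis by (simp add: step_def)
    next
      case False
      with e' have "prefix (w @ [e']) x"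
        using tree_dist_snoc(2)[of w e' x] by (auto simp: step_def)
      with x show ?thesis by simp
    qed
  qed
next
  case False
  then have "w \<noteq> []" by auto
  then have w: "w = butlast w @ [last w]" by simp
  then have last: "arev (last w) \<in> out_arcs G (cover_proj G rt w)"
    using assms(1) by (metis arev_in_arcs cover_proj_snoc in_out_arcs_conv nb_paths_snoc_iff tail_arev)
  show ?thesis
  proof (rule ex1I[of _ "arev (last w)"])
    show "arev (last w) \<in> out_arcs G (cover_proj G rt w) \<and>
        tree_dist x w = Suc (tree_dist x (step w (arev (last w))))"
      using last \<open>w \<noteq> []\<close> False tree_dist_snoc(2)[of "butlast w" "last w" x]
      by (simp add: step_def)
    fix e assume e: "e \<in> out_arcs G (cover_proj G rt w) \<and>
      tree_dist x w = Suc (tree_dist x (step w e))"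
    show "e = arev (last w)"
    proof (rule ccontr)
      assume "e \<noteq> arev (last w)"
      then have "tree_dist x (step w e) = Suc (tree_dist x w)"
        using False tree_dist_snoc(2)[of w e x] append_prefixD by (auto simp: step_def)
      with e show False by simp
    qed
  qed
qed

lemma step_nb_paths:
  assumes "w \<in> nb_paths G arev rt" "e \<in> out_arcs G (cover_proj G rt w)"
  shows "step w e \<in> nb_paths G arev rt"
  using step_mem_cover_lifts[OF assms] by (auto simp: cover_lifts_def universal_cover_def)

text \<open>
  A walk of length \<open>tree_dist x w\<close> arises by repeatedly moving closer to \<open>w\<close>. No walk is shorter,
  because an edge changes the distance to \<open>w\<close> by one.
\<close>

lemma graph_dist_universal_cover:
  assumes "x \<in> nb_paths G arev rt" "w \<in> nb_paths G arev rt"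
  shows "graph_dist (universal_cover G arev rt) x w = tree_dist x w"
proof -
  let ?T = "universal_cover G arev rt"
  interpret T: wf_digraph ?T by (rule wf_universal_cover)
  have ex: "\<exists>p. T.awalk x p w \<and> length p = tree_dist x w"
    using assms(1)
  proof (induction "tree_dist x w" arbitrary: x)
    case 0
    then show ?case by (intro exI[of _ "[]"]) (auto simp: T.awalk_Nil_iff)
  next
    case (Suc n)
    then have "w \<noteq> x" by auto
    with ex1_step_closer[OF \<open>x \<in> _\<close> assms(2)] obtain e where
      e: "e \<in> out_arcs G (cover_proj G rt x)" "tree_dist w x = Suc (tree_dist w (step x e))"
      by blast
    with Suc obtain p where p: "T.awalk (step x e) p w" "length p = tree_dist (step x e) w"
      using step_nb_paths[of x rt e] by (auto simp: tree_dist_sym[of _ w])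
    have "(x, step x e) \<in> arcs ?T" using cover_arc_iff Suc.prems e by blast
    with p e show ?case
      by (intro exI[of _ "(x, step x e) # p"]) (auto simp: T.awalk_Cons_iff tree_dist_sym[of _ w])
  qed
  have le: "tree_dist x w \<le> length p" if "T.awalk x p w" for p
    using that
  proof (induction p arbitrary: x)
    case (Cons a p)
    then obtain x' where a: "a = (x, x')" "(x, x') \<in> arcs ?T" "T.awalk x' p w"
      by (cases a) (auto simp: T.awalk_Cons_iff)
    then have "x \<in> nb_paths G arev rt" by (auto simp: universal_cover_def)
    with a(2) obtain e where "x' = step x e" using cover_arc_iff by blast
    with Cons.IH[OF a(3)] tree_dist_step_cases[of w x e] show ?case
      by (auto simp: tree_dist_sym[of _ w])
  qed (simp add: T.awalk_Nil_iff)
  show ?thesis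
    unfolding graph_dist_def by (rule Least_equality) (use ex le in auto)
qed

lemma graph_sphere_universal_cover:
  assumes "w \<in> nb_paths G arev rt"
  shows "graph_sphere (universal_cover G arev rt) r w = {x \<in> nb_paths G arev rt. tree_dist x w = r}"
  using graph_dist_universal_cover[OF _ assms]
  by (auto simp: graph_sphere_def universal_cover_def)

section \<open>Decomposition of arcs and spheres\<close>

lemma disjoint_UN_equal_card:
  fixes h :: "'c \<Rightarrow> real"
  assumes "finite E"
    and disj: "\<And>e e'. e \<in> E \<Longrightarrow> e' \<in> E \<Longrightarrow> e \<noteq> e' \<Longrightarrow> A e \<inter> A e' = {}"
    and A: "\<And>e. e \<in> E \<Longrightarrow> finite (A e) \<and> card (A e) = n \<and> sum h (A e) = real n * g e"
  shows "finite (\<Union>e\<in>E. A e) \<and> card (\<Union>e\<in>E. A e) = card E * n \<and>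
    sum h (\<Union>e\<in>E. A e) = real n * sum g E"
proof -
  have "card (\<Union>e\<in>E. A e) = (\<Sum>e\<in>E. card (A e))"
    by (rule card_UN_disjoint) (use assms in auto)
  moreover have "sum h (\<Union>e\<in>E. A e) = (\<Sum>e\<in>E. sum h (A e))"
    by (rule sum.UNION_disjoint) (use assms in auto)
  ultimately show ?thesis
    using assms(1) A by (auto simp: sum_distrib_left)
qed

declare graph_arc_set.simps(2) [simp del]

abbreviation cover_arc_set :: "'a \<Rightarrow> nat \<Rightarrow> 'b list \<times> 'b list \<Rightarrow> 'b list set" where
  "cover_arc_set rt r a \<equiv> graph_arc_set (universal_cover G arev rt) r a"

lemma cover_arc_set_Suc:
  assumes "w' \<in> nb_paths G arev rt" "w \<in> nb_paths G arev rt"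
  shows "cover_arc_set rt (Suc r) (w', w)
       = {x \<in> nb_paths G arev rt. tree_dist x w' = Suc r \<and> tree_dist x w = r}"
  using assms by (auto simp: graph_arc_set.simps(2) graph_sphere_universal_cover)

lemma cover_arc_set_step:
  assumes "w \<in> nb_paths G arev rt" "e \<in> out_arcs G (cover_proj G rt w)"
  shows "cover_arc_set rt (Suc r) (w, step w e)
       = {x \<in> nb_paths G arev rt. tree_dist x w = Suc r \<and> tree_dist x (step w e) = r}"
  using assms step_nb_paths by (intro cover_arc_set_Suc) auto

lemma cover_arc_set_1:
  assumes "(w', w) \<in> cover_lifts G arev rt a" "a \<in> arcs G"
  shows "cover_arc_set rt (Suc 0) (w', w) = {w}"
proof -
  note * = cover_liftsD[OF assms]
  have "tree_dist w w' = Suc 0"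
    using tree_dist_step_cases[of w w "arev a"] *(5) by auto
  with * show ?thesis by (subst cover_arc_set_Suc) auto
qed

text \<open>
  Each point other than the centre is sorted by the first edge of the path that leads to it.
\<close>

lemma graph_sphere_Suc_eq_Union:
  assumes "w \<in> nb_paths G arev rt"
  shows "graph_sphere (universal_cover G arev rt) (Suc r) w
       = (\<Union>e\<in>out_arcs G (cover_proj G rt w). cover_arc_set rt (Suc r) (w, step w e))"
proof -
  have "\<exists>e\<in>out_arcs G (cover_proj G rt w). tree_dist x (step w e) = r"
    if "x \<in> nb_paths G arev rt" "tree_dist x w = Suc r" for x
    using ex1_step_closer[OF assms that(1)] that(2) by fastforce
  then show ?thesis
    unfolding graph_sphere_universal_cover[OF assms]
    by (auto simp: cover_arc_set_step[OF assms] simp del: in_out_arcs_conv)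
qed

text \<open>
  The path to a point of the arc passes through \<open>w\<close> and continues with an edge \<open>e\<close> that does not
  lead back to \<open>w'\<close>. The recursion starts at radius \<open>1\<close>: an arc of radius \<open>0\<close> consists of the initial
  vertex alone, which is shared by all the directed edges \<open>e\<close>, so the union would not be disjoint.
\<close>

lemma cover_arc_set_Suc_Suc:
  assumes "(w', w) \<in> cover_lifts G arev rt a" "a \<in> arcs G"
  shows "cover_arc_set rt (Suc (Suc r)) (w', w)
       = (\<Union>e\<in>out_arcs G (head G a) - {arev a}. cover_arc_set rt (Suc r) (w, step w e))"
    (is "?L = ?R")
proof -
  note w = cover_liftsD[OF assms]
  note mem = cover_arc_set_step[OF w(2), unfolded w(4)]
  note unique = ex1_step_closer[OF w(2), unfolded w(4)]
  have arev: "arev a \<in> out_arcs G (head G a)" using assms(2) by simp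
  have L: "?L = {x \<in> nb_paths G arev rt. tree_dist x w' = Suc (Suc r) \<and> tree_dist x w = Suc r}"
    by (rule cover_arc_set_Suc[OF w(1,2)])
  show ?thesis
  proof (intro equalityI subsetI)
    fix x assume "x \<in> ?L"
    then have x: "x \<in> nb_paths G arev rt" "tree_dist x w' = Suc (Suc r)" "tree_dist x w = Suc r"
      unfolding L by auto
    then have "x \<noteq> w" by auto
    with unique x(1) obtain e where
      e: "e \<in> out_arcs G (head G a)" "tree_dist x w = Suc (tree_dist x (step w e))"
      by blast
    then have "e \<noteq> arev a" using x w(5) by auto
    moreover have "x \<in> cover_arc_set rt (Suc r) (w, step w e)"
      using mem[OF e(1)] e(2) x by simp
    ultimately show "x \<in> ?R" using e(1) by blast
  next
    fix x assume "x \<in> ?R"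
    then obtain e where e: "e \<in> out_arcs G (head G a)" "e \<noteq> arev a"
      and "x \<in> cover_arc_set rt (Suc r) (w, step w e)" by blast
    then have x: "x \<in> nb_paths G arev rt" "tree_dist x w = Suc r" "tree_dist x (step w e) = r"
      using mem[OF e(1)] by auto
    then have "x \<noteq> w" by auto
    with unique x e arev have "tree_dist x w \<noteq> Suc (tree_dist x (step w (arev a)))"
      by metis
    then have "tree_dist x w' = Suc (Suc r)"
      using tree_dist_step_cases[of x w "arev a"] w(5) x(2) by auto
    with x show "x \<in> ?L" unfolding L by auto
  qed
qed

lemma cover_arc_set_disjoint:
  assumes "w \<in> nb_paths G arev rt" "e \<in> out_arcs G (cover_proj G rt w)"
    "e' \<in> out_arcs G (cover_proj G rt w)" "e \<noteq> e'"
  shows "cover_arc_set rt (Suc r) (w, step w e) \<inter> cover_arc_set rt (Suc r) (w, step w e') = {}"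
proof (rule ccontr)
  assume "\<not> ?thesis"
  then obtain x where x: "x \<in> nb_paths G arev rt" "tree_dist x w = Suc r"
    "tree_dist x (step w e) = r" "tree_dist x (step w e') = r"
    unfolding cover_arc_set_step[OF assms(1,2)] cover_arc_set_step[OF assms(1,3)] by auto
  then have "x \<noteq> w" by auto
  with ex1_step_closer[OF assms(1) x(1)] x assms show False by metis
qed

end

context regular_bidirected_digraph
begin

text \<open>
  The decomposition of an arc along the \<open>q\<close> continuations of \<open>a\<close> is the recursion that defines the
  iterates of \<open>nb_avg\<close>. The starting function is evaluation at the initial vertex, because the arc
  of radius \<open>0\<close> is the initial vertex.
\<close>

lemma cover_arc_set_sum:
  assumes "(w', w) \<in> cover_lifts G arev rt a" "a \<in> arcs G"
  shows "finite (cover_arc_set rt (Suc r) (w', w)) \<and>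
    card (cover_arc_set rt (Suc r) (w', w)) = q ^ r \<and>
    (\<Sum>x\<in>cover_arc_set rt (Suc r) (w', w). f (cover_proj G rt x))
      = real q ^ r * (nb_avg ^^ Suc r) (\<lambda>b. f (tail G b)) a"
  using assms
proof (induction r arbitrary: w' w a)
  case 0
  have "nb_avg (\<lambda>b. f (tail G b)) a = f (head G a)"
    using nb_avg_tail[OF 0(2), of "\<lambda>b. f (tail G b)" f] by simp
  with cover_liftsD(4)[OF 0] show ?case
    unfolding cover_arc_set_1[OF 0] by simp
next
  case (Suc r)
  note w = cover_liftsD[OF Suc.prems]
  let ?E = "out_arcs G (head G a) - {arev a}"
  let ?A = "\<lambda>e. cover_arc_set rt (Suc r) (w, step w e)"
  let ?g = "(nb_avg ^^ Suc r) (\<lambda>b. f (tail G b))"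
  have "finite ?E" by (simp add: finite_out_arcs)
  moreover have "?A e \<inter> ?A e' = {}" if "e \<in> ?E" "e' \<in> ?E" "e \<noteq> e'" for e e'
    using cover_arc_set_disjoint[OF w(2), unfolded w(4)] that by blast
  moreover have "finite (?A e) \<and> card (?A e) = q ^ r \<and>
      (\<Sum>x\<in>?A e. f (cover_proj G rt x)) = real (q ^ r) * ?g e" if "e \<in> ?E" for e
    using Suc.IH[of w "step w e" e] step_mem_cover_lifts[OF w(2), of e] w(4) that by auto
  ultimately have "finite (\<Union>e\<in>?E. ?A e) \<and> card (\<Union>e\<in>?E. ?A e) = card ?E * q ^ r \<and>
    (\<Sum>x\<in>(\<Union>e\<in>?E. ?A e). f (cover_proj G rt x)) = real (q ^ r) * sum ?g ?E"
    by (rule disjoint_UN_equal_card)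
  moreover have "sum ?g ?E = real q * (nb_avg ^^ Suc (Suc r)) (\<lambda>b. f (tail G b)) a"
    using q_ge_2 unfolding funpow.simps(2)[of "Suc r"] comp_apply nb_avg_def[of _ a] by simp
  ultimately show ?case
    unfolding cover_arc_set_Suc_Suc[OF Suc.prems] card_successors[OF Suc.prems(2)]
    by (simp del: funpow.simps)
qed

lemma arc_mean_eq_nb_avg_pow:
  assumes "(w', w) \<in> cover_lifts G arev rt a" "a \<in> arcs G"
  shows "arc_mean G arev rt f r (w', w) = (nb_avg ^^ r) (\<lambda>b. f (tail G b)) a"
proof (cases r)
  case 0
  then show ?thesis
    using cover_liftsD(3)[OF assms] by (simp add: arc_mean_def mean_on_def)
next
  case (Suc n)
  with cover_arc_set_sum[OF assms, of n f] q_ge_2 show ?thesis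
    by (simp add: arc_mean_def mean_on_def del: funpow.simps)
qed

lemma cover_proj_in_verts: "w \<in> nb_paths G arev rt \<Longrightarrow> cover_proj G rt w \<in> verts G"
  by (auto simp: nb_paths_def cover_proj_def intro: awlast_in_verts)

lemma sphere_mean_eq_nb_avg_pow:
  assumes "w \<in> nb_paths G arev rt"
  shows "sphere_mean G arev rt f r w
    = mean_on (out_arcs G (cover_proj G rt w)) ((nb_avg ^^ r) (\<lambda>b. f (tail G b)))"
proof (cases r)
  case 0
  have "graph_sphere (universal_cover G arev rt) 0 w = {w}"
    using assms by (auto simp: graph_sphere_universal_cover)
  with 0 card_out_arcs[OF cover_proj_in_verts[OF assms]] show ?thesis
    by (simp add: sphere_mean_def mean_on_def out_arcs_def)
next
  case (Suc n)
  let ?E = "out_arcs G (cover_proj G rt w)"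
  let ?A = "\<lambda>e. cover_arc_set rt (Suc n) (w, step w e)"
  let ?g = "(nb_avg ^^ r) (\<lambda>b. f (tail G b))"
  have "finite ?E" by (simp add: finite_out_arcs)
  moreover have "?A e \<inter> ?A e' = {}" if "e \<in> ?E" "e' \<in> ?E" "e \<noteq> e'" for e e'
    using cover_arc_set_disjoint[OF assms] that by blast
  moreover have "finite (?A e) \<and> card (?A e) = q ^ n \<and>
      (\<Sum>x\<in>?A e. f (cover_proj G rt x)) = real (q ^ n) * ?g e" if "e \<in> ?E" for e
    using cover_arc_set_sum[OF step_mem_cover_lifts[OF assms that], of n f] that Suc by auto
  ultimately have "finite (\<Union>e\<in>?E. ?A e) \<and> card (\<Union>e\<in>?E. ?A e) = card ?E * q ^ n \<and>
    (\<Sum>x\<in>(\<Union>e\<in>?E. ?A e). f (cover_proj G rt x)) = real (q ^ n) * sum ?g ?E"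
    by (rule disjoint_UN_equal_card)
  then show ?thesis
    unfolding sphere_mean_def mean_on_def Suc graph_sphere_Suc_eq_Union[OF assms]
    using q_ge_2 by (simp del: funpow.simps)
qed

section \<open>Exponential convergence of the means\<close>

lemma nb_avg_pow_diff_const:
  assumes "a \<in> arcs G"
  shows "(nb_avg ^^ r) (\<lambda>b. g b - c) a = (nb_avg ^^ r) g a - c"
  using assms
proof (induction r arbitrary: a)
  case (Suc r)
  have "nb_avg ((nb_avg ^^ r) (\<lambda>b. g b - c)) a = nb_avg (\<lambda>b. (nb_avg ^^ r) g b - c) a"
    by (intro nb_avg_cong Suc.IH)
  with Suc.prems show ?case by (simp add: nb_avg_diff_const)
qed simp

lemma sum_arcs_tail:
  fixes h :: "'a \<Rightarrow> real"
  shows "(\<Sum>a\<in>arcs G. h (tail G a)) = (real q + 1) * (\<Sum>v\<in>verts G. h v)"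
  unfolding sum_arcs_by_tail sum_distrib_left
  using card_out_arcs by (intro sum.cong refl) (simp add: out_arcs_def)

text \<open>
  The function \<open>f (tail G b) - m\<close> has mean zero over the directed edges, as every vertex is the
  initial vertex of \<open>q + 1\<close> of them; for the same reason its energy is at most
  \<open>(q + 1) * (L2_set f (verts G))\<^sup>2\<close>. Decay of the energy then bounds every single value.
\<close>

lemma nb_avg_pow_tail_bound:
  fixes f :: "'a \<Rightarrow> real"
  assumes "1 / real q \<le> \<beta>\<^sup>2" "\<beta> \<ge> 0"
    and "\<And>g. sum g (arcs G) = 0 \<Longrightarrow> energy (nb_avg (nb_avg g)) \<le> \<beta> ^ 4 * energy g"
    and a: "a \<in> arcs G"
  shows "\<bar>(nb_avg ^^ r) (\<lambda>b. f (tail G b)) a - mean_on (verts G) f\<bar>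
    \<le> sqrt (real q * (real q + 1)) * L2_set f (verts G) * \<beta> ^ r"
proof -
  define m where "m = mean_on (verts G) f"
  define g where "g = (\<lambda>b. f (tail G b) - m)"
  have "card (verts G) > 0" using tail_in_verts[OF a] by (auto simp: card_gt_0_iff)
  then have m: "(\<Sum>v\<in>verts G. f v) = card (verts G) * m"
    by (simp add: m_def mean_on_def)
  have g0: "sum g (arcs G) = 0"
    using sum_arcs_tail[of "\<lambda>v. f v - m"] by (simp add: g_def sum_subtractf m)
  have "energy g = (real q + 1) * (\<Sum>v\<in>verts G. (f v - m)\<^sup>2)"
    using sum_arcs_tail[of "\<lambda>v. (f v - m)\<^sup>2"] by (simp add: g_def energy_def)
  also have "(\<Sum>v\<in>verts G. (f v - m)\<^sup>2) = (\<Sum>v\<in>verts G. (f v)\<^sup>2) - card (verts G) * m\<^sup>2"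
  proof -
    have "(\<Sum>v\<in>verts G. (f v - m)\<^sup>2) = (\<Sum>v\<in>verts G. (f v)\<^sup>2 - 2 * m * f v + m\<^sup>2)"
      by (simp add: power2_diff mult_ac add_ac algebra_simps)
    also have "\<dots> = (\<Sum>v\<in>verts G. (f v)\<^sup>2) - 2 * m * (\<Sum>v\<in>verts G. f v) + card (verts G) * m\<^sup>2"
      by (simp add: sum.distrib sum_subtractf sum_distrib_left)
    finally show ?thesis by (simp add: m power2_eq_square)
  qed
  also have "\<dots> \<le> (\<Sum>v\<in>verts G. (f v)\<^sup>2)" by simp
  finally have g: "energy g \<le> (real q + 1) * (\<Sum>v\<in>verts G. (f v)\<^sup>2)"
    by (simp add: mult_left_mono)
  have "((nb_avg ^^ r) g a)\<^sup>2 \<le> energy ((nb_avg ^^ r) g)"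
    unfolding energy_def by (rule member_le_sum) (use a in auto)
  also have "\<dots> \<le> real q * \<beta> ^ (2 * r) * energy g"
    by (rule energy_nb_avg_pow_le[OF assms(1) assms(3) g0])
  also have "\<dots> \<le> real q * \<beta> ^ (2 * r) * ((real q + 1) * (\<Sum>v\<in>verts G. (f v)\<^sup>2))"
    using g by (intro mult_left_mono) auto
  finally have "sqrt (((nb_avg ^^ r) g a)\<^sup>2)
      \<le> sqrt (real q * \<beta> ^ (2 * r) * ((real q + 1) * (\<Sum>v\<in>verts G. (f v)\<^sup>2)))"
    by (rule real_sqrt_le_mono)
  also have "\<dots> = sqrt (real q * (real q + 1)) * L2_set f (verts G) * \<beta> ^ r"
  proof -
    have eq: "real q * \<beta> ^ (2 * r) * ((real q + 1) * (\<Sum>v\<in>verts G. (f v)\<^sup>2))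
        = (real q * (real q + 1)) * (\<Sum>v\<in>verts G. (f v)\<^sup>2) * (\<beta> ^ r)\<^sup>2"
      by (simp add: power_even_eq)
    show ?thesis
      unfolding eq using \<open>\<beta> \<ge> 0\<close> by (simp add: L2_set_def real_sqrt_mult)
  qed
  finally show ?thesis
    using nb_avg_pow_diff_const[OF a, of r "\<lambda>b. f (tail G b)" m] by (simp add: g_def m_def)
qed

end

lemma abs_mean_on_diff_le:
  assumes "finite A" "A \<noteq> {}" "\<And>x. x \<in> A \<Longrightarrow> \<bar>f x - c\<bar> \<le> B"
  shows "\<bar>mean_on A f - c\<bar> \<le> B"
proof -
  have n: "card A > 0" using assms by (simp add: card_gt_0_iff)
  then have "mean_on A f - c = (\<Sum>x\<in>A. f x - c) / card A"
    by (simp add: mean_on_def sum_subtractf field_simps)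
  moreover have "\<bar>\<Sum>x\<in>A. f x - c\<bar> \<le> card A * B"
    by (rule order_trans[OF sum_abs sum_bounded_above[OF assms(3)]])
  ultimately show ?thesis using n by (simp add: abs_divide divide_le_eq mult.commute)
qed

theorem corollary1:
  fixes G :: "('a, 'b) pre_digraph" and arev :: "'b \<Rightarrow> 'b" and q :: nat
  assumes "fin_digraph G" and "bidirected_digraph G arev"
    and "Digraph_Component.connected G" and "\<not> bipartite G"
    and "q \<ge> 2" and "\<forall>v \<in> verts G. out_degree G v = q + 1"
  shows "\<exists>C > 0. \<forall>f :: 'a \<Rightarrow> real. \<exists>\<beta>. real q powr (- 1 / 2) \<le> \<beta> \<and> \<beta> < 1 \<and>
    (\<forall>rt \<in> verts G.
      (\<forall>a \<in> arcs G. \<forall>a' \<in> cover_lifts G arev rt a. \<forall>r.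
         \<bar>arc_mean G arev rt f r a' - mean_on (verts G) f\<bar> \<le> C * L2_set f (verts G) * \<beta> ^ r) \<and>
      (\<forall>v\<^sub>0 \<in> verts (universal_cover G arev rt). \<forall>r.
         \<bar>sphere_mean G arev rt f r v\<^sub>0 - mean_on (verts G) f\<bar> \<le> C * L2_set f (verts G) * \<beta> ^ r))"
proof -
  interpret fin_digraph G by fact
  interpret bidirected_digraph G arev by fact
  interpret regular_bidirected_digraph G arev q
    by unfold_locales (use assms(5,6) in \<open>auto simp: out_degree_def\<close>)
  obtain \<rho> where \<rho>: "0 \<le> \<rho>" "\<rho> < 1"
    "\<And>g. sum g (arcs G) = 0 \<Longrightarrow> energy (nb_avg (nb_avg g)) \<le> \<rho> * energy g"
    using energy_nb_avg_twice_contracts[OF assms(3,4)] by blast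
  \<comment> \<open>Two steps contract the energy by \<open>\<rho>\<close>, hence the norm by \<open>sqrt \<rho>\<close>; one step accounts for the
    fourth root.\<close>
  define \<beta> where "\<beta> = max (real q powr (- 1 / 2)) (root 4 \<rho>)"
  have q: "real q > 1" using \<open>q \<ge> 2\<close> by simp
  have "real q powr (- 1 / 2) < 1" using q powr_less_one by simp
  with \<rho> have \<beta>1: "\<beta> < 1" by (simp add: \<beta>_def)
  have \<beta>_ge: "real q powr (- 1 / 2) \<le> \<beta>" "root 4 \<rho> \<le> \<beta>" by (simp_all add: \<beta>_def)
  then have \<beta>0: "\<beta> \<ge> 0" using powr_ge_zero order_trans by blast
  have "(real q powr (- 1 / 2))\<^sup>2 \<le> \<beta>\<^sup>2" using \<beta>_ge(1) by (intro power_mono) auto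
  then have \<beta>2: "1 / real q \<le> \<beta>\<^sup>2"
    using q by (simp add: powr_minus powr_half_sqrt inverse_eq_divide power_one_over)
  have "\<rho> = root 4 \<rho> ^ 4" using \<rho>(1) by simp
  also have "\<dots> \<le> \<beta> ^ 4" using \<beta>_ge(2) \<rho>(1) by (intro power_mono) auto
  finally have "\<rho> \<le> \<beta> ^ 4" .
  then have contr: "energy (nb_avg (nb_avg g)) \<le> \<beta> ^ 4 * energy g" if "sum g (arcs G) = 0" for g
    using \<rho>(3)[OF that] mult_right_mono[of \<rho> "\<beta> ^ 4" "energy g"]
    by (simp add: energy_def sum_nonneg)
  note bound = nb_avg_pow_tail_bound[OF \<beta>2 \<beta>0 contr]
  show ?thesis
  proof (rule exI[of _ "sqrt (real q * (real q + 1))"], intro conjI allI)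
    show "sqrt (real q * (real q + 1)) > 0" using q by simp
  next
    fix f :: "'a \<Rightarrow> real"
    show "\<exists>\<beta>. real q powr (- 1 / 2) \<le> \<beta> \<and> \<beta> < 1 \<and>
      (\<forall>rt \<in> verts G.
        (\<forall>a \<in> arcs G. \<forall>a' \<in> cover_lifts G arev rt a. \<forall>r.
           \<bar>arc_mean G arev rt f r a' - mean_on (verts G) f\<bar>
             \<le> sqrt (real q * (real q + 1)) * L2_set f (verts G) * \<beta> ^ r) \<and>
        (\<forall>v\<^sub>0 \<in> verts (universal_cover G arev rt). \<forall>r.
           \<bar>sphere_mean G arev rt f r v\<^sub>0 - mean_on (verts G) f\<bar>
             \<le> sqrt (real q * (real q + 1)) * L2_set f (verts G) * \<beta> ^ r))"
    proof (rule exI[of _ \<beta>], intro conjI allI ballI)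
      fix rt a a' r
      assume "a \<in> arcs G" "a' \<in> cover_lifts G arev rt a"
      then show "\<bar>arc_mean G arev rt f r a' - mean_on (verts G) f\<bar>
          \<le> sqrt (real q * (real q + 1)) * L2_set f (verts G) * \<beta> ^ r"
        using bound by (cases a') (simp add: arc_mean_eq_nb_avg_pow)
    next
      fix rt w r
      assume "w \<in> verts (universal_cover G arev rt)"
      then have w: "w \<in> nb_paths G arev rt" by simp
      have "card (out_arcs G (cover_proj G rt w)) > 0"
        using card_out_arcs[OF cover_proj_in_verts[OF w]] by simp
      then show "\<bar>sphere_mean G arev rt f r w - mean_on (verts G) f\<bar>
          \<le> sqrt (real q * (real q + 1)) * L2_set f (verts G) * \<beta> ^ r"
        unfolding sphere_mean_eq_nb_avg_pow[OF w]
        by (intro abs_mean_on_diff_le bound) (auto simp: card_gt_0_iff)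
    qed (use \<beta>1 \<beta>_ge in auto)
  qed
qed

end
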